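(* Let $a_0\in\mathbb{R}$ and consider, for radial functions $u=u(r,t)$ on the unit disc ($r\in[0,1]$), the equation $$u_t=\frac{u_r\,u_{rr}}{r}-\Delta_r^2u,\qquad \Delta_r(\cdot)=\frac1r[r(\cdot)_r]_r,$$ subject to the boundary conditions $$3\,\partial_ru(1,t)=\partial_r^2u(1,t),\qquad 2\,\partial_r^2u(1,t)=\partial_r^3u(1,t),\qquad \partial_ru(0,t)=\partial_r^3u(0,t)=0.$$ This problem admits the explicit solution $$u(r,t)=\frac{a_0}{1-48a_0t}\,r^4+\frac43\ln(1-48a_0t),$$ for $t\ge0$ with $1-48a_0t>0$. Moreover: (i) if $a_0=0$, then $u\equiv0$ for all times; (ii) if $a_0<0$, then the solution exists for all $t\ge0$ and blows up in infinite time, with $\lim_{t\nearrow\infty}u(r,t)=+\infty$ for all $r\in[0,1]$; (iii) if $a_0>0$, then the solution blows up in finite time at $T^*=\frac{1}{48a_0}$, with $\lim_{t\nearrow T^*}u(0,t)=-\infty$ and $\lim_{t\nearrow T^*}u(r,t)=+\infty$ for all $r\in(0,1]$.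
   Context: Here $r=\sqrt{x^2+y^2}$ and the equation is the radial form of $u_t=\det(D^2u)-\Delta^2u$ in the plane, where $D^2u$ is the spatial Hessian matrix. $\Delta_r^2u=\Delta_r(\Delta_ru)$. "Solution" means that the (smooth) function satisfies the equation (for $r\in(0,1]$, and at $r=0$ in the sense of the Cartesian form of the equation) and the boundary conditions pointwise. *)

theory Defs
  imports "HOL-Analysis.Analysis"
begin

(* C^k regularity on a set S that need not be open: derivatives are taken within S, so they are
   one-sided at boundary points of S. *)
primrec Ck_on :: "nat \<Rightarrow> 'a::euclidean_space set \<Rightarrow> ('a \<Rightarrow> real) \<Rightarrow> bool" where
  "Ck_on 0 S f \<longleftrightarrow> continuous_on S f"
| "Ck_on (Suc k) S f \<longleftrightarrow>
     (\<exists>D. (\<forall>p\<in>S. (f has_derivative D p) (at p within S)) \<and> (\<forall>b\<in>Basis. Ck_on k S (\<lambda>p. D p b)))"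

definition smooth_on :: "'a::euclidean_space set \<Rightarrow> ('a \<Rightarrow> real) \<Rightarrow> bool" where
  "smooth_on S f \<longleftrightarrow> (\<forall>k. Ck_on k S f)"

(* Radial profiles live on [0,1]; the derivative is one-sided at r = 0 and r = 1. *)
definition Dr :: "(real \<Rightarrow> real) \<Rightarrow> real \<Rightarrow> real" where
  "Dr f r = vector_derivative f (at r within {0..1})"

(* Only meant for r > 0. The value at r = 0 (where 1 / 0 = 0) is irrelevant, also when the operator
   is iterated, because derivatives at r > 0 do not see it. *)
definition radial_laplacian :: "(real \<Rightarrow> real) \<Rightarrow> real \<Rightarrow> real" where
  "radial_laplacian f r = 1 / r * Dr (\<lambda>s. s * Dr f s) r"

definition partial :: "'n::finite \<Rightarrow> (real ^ 'n \<Rightarrow> real) \<Rightarrow> real ^ 'n \<Rightarrow> real" where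
  "partial i V p = deriv (\<lambda>h. V (p + h *\<^sub>R axis i 1)) 0"

definition hessian :: "(real ^ 'n \<Rightarrow> real) \<Rightarrow> real ^ 'n \<Rightarrow> real ^ 'n ^ 'n" where
  "hessian V p = (\<chi> i j. partial i (partial j V) p)"

definition laplacian :: "(real ^ 'n \<Rightarrow> real) \<Rightarrow> real ^ 'n \<Rightarrow> real" where
  "laplacian V p = (\<Sum>i\<in>UNIV. partial i (partial i V) p)"

definition cartesian :: "(real \<Rightarrow> real \<Rightarrow> real) \<Rightarrow> real \<Rightarrow> real ^ 2 \<Rightarrow> real" where
  "cartesian u t p = u (norm p) t"

(* u r t solves the radial problem for the times in the (nondegenerate) interval J; the time
   derivative is one-sided at end points belonging to J. Smoothness of u means smoothness of the
   radial function on the closed disc in Cartesian coordinates; restricting to a ray, it implies that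
   (r,t) \<mapsto> u r t is smooth on [0,1] \<times> J, so all the derivatives below exist. *)
definition radial_solution :: "real set \<Rightarrow> (real \<Rightarrow> real \<Rightarrow> real) \<Rightarrow> bool" where
  "radial_solution J u \<longleftrightarrow>
     smooth_on (cball 0 1 \<times> J) (\<lambda>(p, t). cartesian u t p) \<and>
     (\<forall>t\<in>J.
        (\<forall>r\<in>{0<..1}.
           vector_derivative (\<lambda>s. u r s) (at t within J)
             = Dr (\<lambda>r. u r t) r * Dr (Dr (\<lambda>r. u r t)) r / r
               - radial_laplacian (radial_laplacian (\<lambda>r. u r t)) r) \<and>
        vector_derivative (\<lambda>s. cartesian u s 0) (at t within J)
          = det (hessian (cartesian u t) 0) - laplacian (laplacian (cartesian u t)) 0 \<and>
        3 * Dr (\<lambda>r. u r t) 1 = (Dr ^^ 2) (\<lambda>r. u r t) 1 \<and>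
        2 * (Dr ^^ 2) (\<lambda>r. u r t) 1 = (Dr ^^ 3) (\<lambda>r. u r t) 1 \<and>
        Dr (\<lambda>r. u r t) 0 = 0 \<and>
        (Dr ^^ 3) (\<lambda>r. u r t) 0 = 0)"

(* The sup norm over the disc diverges as time runs along the filter F
   (at_left T for blow-up at time T, at_top for blow-up in infinite time). *)
definition blows_up :: "(real \<Rightarrow> real \<Rightarrow> real) \<Rightarrow> real filter \<Rightarrow> bool" where
  "blows_up u F \<longleftrightarrow> filterlim (\<lambda>t. SUP r\<in>{0..1}. \<bar>u r t\<bar>) at_top F"

definition explicit_solution :: "real \<Rightarrow> real \<Rightarrow> real \<Rightarrow> real" where
  "explicit_solution a0 r t = a0 / (1 - 48 * a0 * t) * r ^ 4 + 4 / 3 * ln (1 - 48 * a0 * t)"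

end

theory Submission
  imports Defs "HOL-Real_Asymp.Real_Asymp"
begin

text \<open>
  Write \<open>A(t) = a0 / (1 - 48 a0 t)\<close> and \<open>c(t) = (4/3) ln (1 - 48 a0 t)\<close>, so that the function is
  \<open>A(t) r^4 + c(t)\<close>. For a profile \<open>A r^4 + c\<close> the determinant term is \<open>48 A^2 r^4\<close> and the bilaplacian
  is \<open>64 A\<close>, so the equation splits into \<open>A' = 48 A^2\<close> and \<open>c' = -64 A\<close>, which is exactly what the
  two coefficients satisfy. The boundary conditions are identities between the derivatives
  \<open>4 A r^3\<close>, \<open>12 A r^2\<close>, \<open>24 A r\<close>. At the origin all second derivatives of \<open>A |p|^4 + c\<close> vanish,
  so the determinant of the Hessian contributes nothing there.

  Smoothness on the closed disc holds because \<open>|p|^4\<close> is a polynomial in the coordinates and the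
  coefficients are obtained from the affine function \<open>1 - 48 a0 t > 0\<close> by inversion and logarithm;
  the class of \<open>C^k\<close> functions on an arbitrary set is closed under these operations
  (\<open>Ck_on_add\<close>, \<open>Ck_on_mult\<close>, \<open>Ck_on_inverse\<close>, \<open>Ck_on_ln\<close>).

  The limits follow from the behaviour of \<open>g = 1 - 48 a0 t\<close>: if \<open>a0 < 0\<close> then \<open>g\<close> tends to infinity
  and the logarithm dominates; if \<open>a0 > 0\<close> then \<open>g\<close> decreases to \<open>0\<close>, where \<open>a0 r^4 / g\<close> dominates
  the logarithm unless \<open>r = 0\<close>. The sup norm is bounded below by the absolute value at the origin,
  which diverges in both cases (\<open>blows_up_if_diverges_at\<close>).
\<close>

section \<open>Closure properties of functions of class C^k on a set\<close>

lemma Ck_on_SucD: "Ck_on (Suc k) S f \<Longrightarrow> Ck_on k S f"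
proof (induction k arbitrary: f)
  case 0
  then show ?case
    by (auto simp: continuous_on_eq_continuous_within intro: has_derivative_continuous)
next
  case (Suc k)
  from Suc.prems obtain D
    where D: "\<forall>p\<in>S. (f has_derivative D p) (at p within S)"
      and DC: "\<forall>b\<in>Basis. Ck_on (Suc k) S (\<lambda>p. D p b)"
    unfolding Ck_on.simps(2)[of "Suc k"] by blast
  from DC have "\<forall>b\<in>Basis. Ck_on k S (\<lambda>p. D p b)"
    using Suc.IH by blast
  with D show ?case
    by auto
qed

lemma Ck_on_const: "Ck_on k S (\<lambda>p. c)"
proof (induction k arbitrary: c)
  case (Suc k)
  have "\<forall>p\<in>S. ((\<lambda>p. c) has_derivative (\<lambda>h. 0)) (at p within S)"
    by simp
  then show ?case
    unfolding Ck_on.simps using Suc.IH by (intro exI[of _ "\<lambda>p h. 0"]) auto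
qed simp

lemma Ck_on_bounded_linear:
  assumes "bounded_linear f"
  shows "Ck_on k S f"
proof (cases k)
  case 0
  then show ?thesis
    using assms by (simp add: linear_continuous_on)
next
  case (Suc m)
  have "\<forall>p\<in>S. (f has_derivative f) (at p within S)"
    using assms by (simp add: bounded_linear_imp_has_derivative)
  then show ?thesis
    unfolding Suc Ck_on.simps
    by (intro exI[of _ "\<lambda>p. f"]) (auto intro: Ck_on_const)
qed

lemma Ck_on_add: "Ck_on k S f \<Longrightarrow> Ck_on k S g \<Longrightarrow> Ck_on k S (\<lambda>p. f p + g p)"
proof (induction k arbitrary: f g)
  case 0
  then show ?case
    by (simp add: continuous_on_add)
next
  case (Suc k)
  from Suc.prems(1) obtain D
    where D: "\<forall>p\<in>S. (f has_derivative D p) (at p within S)"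
      and DC: "\<forall>b\<in>Basis. Ck_on k S (\<lambda>p. D p b)"
    by auto
  from Suc.prems(2) obtain E
    where E: "\<forall>p\<in>S. (g has_derivative E p) (at p within S)"
      and EC: "\<forall>b\<in>Basis. Ck_on k S (\<lambda>p. E p b)"
    by auto
  have "\<forall>p\<in>S. ((\<lambda>p. f p + g p) has_derivative (\<lambda>h. D p h + E p h)) (at p within S)"
    using D E by (auto intro: has_derivative_add)
  moreover have "\<forall>b\<in>Basis. Ck_on k S (\<lambda>p. D p b + E p b)"
    using DC EC Suc.IH by blast
  ultimately show ?case
    unfolding Ck_on.simps by (intro exI[of _ "\<lambda>p h. D p h + E p h"]) auto
qed

lemma Ck_on_mult: "Ck_on k S f \<Longrightarrow> Ck_on k S g \<Longrightarrow> Ck_on k S (\<lambda>p. f p * g p)"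
proof (induction k arbitrary: f g)
  case 0
  then show ?case
    by (simp add: continuous_on_mult)
next
  case (Suc k)
  note fg = Suc.prems[THEN Ck_on_SucD]
  from Suc.prems(1) obtain D
    where D: "\<forall>p\<in>S. (f has_derivative D p) (at p within S)"
      and DC: "\<forall>b\<in>Basis. Ck_on k S (\<lambda>p. D p b)"
    by auto
  from Suc.prems(2) obtain E
    where E: "\<forall>p\<in>S. (g has_derivative E p) (at p within S)"
      and EC: "\<forall>b\<in>Basis. Ck_on k S (\<lambda>p. E p b)"
    by auto
  have "\<forall>p\<in>S. ((\<lambda>p. f p * g p) has_derivative (\<lambda>h. f p * E p h + D p h * g p)) (at p within S)"
    using D E by (auto intro: has_derivative_mult)
  moreover have "\<forall>b\<in>Basis. Ck_on k S (\<lambda>p. f p * E p b + D p b * g p)"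
  proof
    fix b :: 'a assume b: "b \<in> Basis"
    show "Ck_on k S (\<lambda>p. f p * E p b + D p b * g p)"
      by (rule Ck_on_add[OF Suc.IH[OF fg(1) bspec[OF EC b]] Suc.IH[OF bspec[OF DC b] fg(2)]])
  qed
  ultimately show ?case
    unfolding Ck_on.simps by (intro exI[of _ "\<lambda>p h. f p * E p h + D p h * g p"]) auto
qed

lemma Ck_on_inverse:
  assumes "Ck_on k S f" and nz: "\<And>p. p \<in> S \<Longrightarrow> f p \<noteq> 0"
  shows "Ck_on k S (\<lambda>p. inverse (f p))"
  using assms(1)
proof (induction k)
  case 0
  then show ?case
    using nz by (simp add: continuous_on_inverse)
next
  case (Suc k)
  have inv: "Ck_on k S (\<lambda>p. inverse (f p))"
    using Suc Ck_on_SucD by blast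
  from Suc.prems obtain D
    where D: "\<forall>p\<in>S. (f has_derivative D p) (at p within S)"
      and DC: "\<forall>b\<in>Basis. Ck_on k S (\<lambda>p. D p b)"
    by auto
  define E where "E p h = (-1) * (inverse (f p) * D p h * inverse (f p))" for p h
  have "\<forall>p\<in>S. ((\<lambda>p. inverse (f p)) has_derivative (\<lambda>h. E p h)) (at p within S)"
    using D nz unfolding E_def by (auto intro!: has_derivative_inverse)
  moreover have "\<forall>b\<in>Basis. Ck_on k S (\<lambda>p. E p b)"
    unfolding E_def using DC inv by (intro ballI Ck_on_mult Ck_on_const) auto
  ultimately show ?case
    unfolding Ck_on.simps by blast
qed

lemma Ck_on_ln:
  assumes "Ck_on k S f" and pos: "\<And>p. p \<in> S \<Longrightarrow> f p > 0"
  shows "Ck_on k S (\<lambda>p. ln (f p))"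
proof (cases k)
  case 0
  have "\<forall>p\<in>S. f p \<noteq> 0"
    using pos by force
  with 0 show ?thesis
    using assms(1) by (simp add: continuous_on_ln)
next
  case (Suc m)
  have "f p \<noteq> 0" if "p \<in> S" for p
    using pos[OF that] by simp
  then have inv: "Ck_on m S (\<lambda>p. inverse (f p))"
    using assms(1) Ck_on_SucD Ck_on_inverse unfolding Suc by blast
  from assms(1) obtain D
    where D: "\<forall>p\<in>S. (f has_derivative D p) (at p within S)"
      and DC: "\<forall>b\<in>Basis. Ck_on m S (\<lambda>p. D p b)"
    unfolding Suc by auto
  have "\<forall>p\<in>S. ((\<lambda>p. ln (f p)) has_derivative (\<lambda>h. D p h * inverse (f p))) (at p within S)"
    using D pos by (auto intro!: derivative_eq_intros simp: divide_inverse)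
  moreover have "\<forall>b\<in>Basis. Ck_on m S (\<lambda>p. D p b * inverse (f p))"
    using DC inv by (intro ballI Ck_on_mult) auto
  ultimately show ?thesis
    unfolding Suc Ck_on.simps by (intro exI[of _ "\<lambda>p h. D p h * inverse (f p)"]) auto
qed

section \<open>Derivatives of quartic profiles\<close>

text \<open>Since \<open>Dr\<close> only looks at \<open>[0, 1]\<close>, an iterated \<open>Dr\<close> can be computed from a closed form of
  the inner one that is valid on \<open>[0, 1]\<close> only.\<close>

lemma Dr_eqI:
  assumes "\<And>s. s \<in> {0..1} \<Longrightarrow> f s = g s" "(g has_real_derivative d) (at r)" "r \<in> {0..1}"
  shows "Dr f r = d"
proof -
  have "(g has_real_derivative d) (at r within {0..1})"
    using assms(2) by (rule has_field_derivative_at_within)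
  then have "(g has_vector_derivative d) (at r within {0..1})"
    by (simp add: has_real_derivative_iff_has_vector_derivative)
  then have "(f has_vector_derivative d) (at r within {0..1})"
    using assms(1,3) by (rule_tac has_vector_derivative_transform[of r "{0..1}" f g]) auto
  then show ?thesis
    unfolding Dr_def using assms(3)
    by (intro vector_derivative_within_cbox[of 0 1, unfolded box_real]) auto
qed

lemma
  fixes A c :: real
  assumes r: "r \<in> {0..1}"
  shows Dr_quartic: "Dr (\<lambda>r. A * r ^ 4 + c) r = 4 * A * r ^ 3"
    and Dr2_quartic: "Dr (Dr (\<lambda>r. A * r ^ 4 + c)) r = 12 * A * r ^ 2"
    and Dr3_quartic: "Dr (Dr (Dr (\<lambda>r. A * r ^ 4 + c))) r = 24 * A * r"
proof -
  have 1: "Dr (\<lambda>r. A * r ^ 4 + c) s = 4 * A * s ^ 3" if "s \<in> {0..1}" for s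
    using that by (intro Dr_eqI[OF refl]) (auto intro!: derivative_eq_intros)
  have 2: "Dr (Dr (\<lambda>r. A * r ^ 4 + c)) s = 12 * A * s ^ 2" if "s \<in> {0..1}" for s
    using that by (intro Dr_eqI[OF 1]) (auto intro!: derivative_eq_intros)
  show "Dr (Dr (Dr (\<lambda>r. A * r ^ 4 + c))) r = 24 * A * r"
    using r by (intro Dr_eqI[OF 2]) (auto intro!: derivative_eq_intros)
  show "Dr (\<lambda>r. A * r ^ 4 + c) r = 4 * A * r ^ 3" "Dr (Dr (\<lambda>r. A * r ^ 4 + c)) r = 12 * A * r ^ 2"
    using 1 2 r by auto
qed

lemma radial_bilaplacian_quartic:
  fixes A c :: real
  assumes r: "r \<in> {0<..1}"
  shows "radial_laplacian (radial_laplacian (\<lambda>r. A * r ^ 4 + c)) r = 64 * A"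
proof -
  have "Dr (\<lambda>s. s * Dr (\<lambda>r. A * r ^ 4 + c) s) s = 16 * A * s ^ 3" if "s \<in> {0..1}" for s
  proof (rule Dr_eqI[OF _ _ that])
    show "s * Dr (\<lambda>r. A * r ^ 4 + c) s = 4 * A * s ^ 4" if "s \<in> {0..1}" for s
      unfolding Dr_quartic[OF that] by (simp add: power4_eq_xxxx power3_eq_cube)
  qed (auto intro!: derivative_eq_intros)
  \<comment> \<open>The identity persists at \<open>s = 0\<close>, where both sides are \<open>0\<close>.\<close>
  then have 1: "radial_laplacian (\<lambda>r. A * r ^ 4 + c) s = 16 * A * s ^ 2" if "s \<in> {0..1}" for s
    using that unfolding radial_laplacian_def by (simp add: power3_eq_cube power2_eq_square)
  have 2: "Dr (radial_laplacian (\<lambda>r. A * r ^ 4 + c)) s = 32 * A * s" if "s \<in> {0..1}" for s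
    using that by (intro Dr_eqI[OF 1]) (auto intro!: derivative_eq_intros)
  have "Dr (\<lambda>s. s * Dr (radial_laplacian (\<lambda>r. A * r ^ 4 + c)) s) r = 64 * A * r"
  proof (rule Dr_eqI)
    show "s * Dr (radial_laplacian (\<lambda>r. A * r ^ 4 + c)) s = 32 * A * s ^ 2" if "s \<in> {0..1}" for s
      using that by (simp add: 2 power2_eq_square)
  qed (use r in \<open>auto intro!: derivative_eq_intros\<close>)
  with r show ?thesis
    unfolding radial_laplacian_def[of "radial_laplacian _"] by simp
qed

lemma partial_eqI:
  assumes "((\<lambda>h. V (p + h *\<^sub>R axis i 1)) has_real_derivative d) (at 0)"
  shows "partial i V p = d"
  unfolding partial_def using assms by (rule DERIV_imp_deriv)

lemma norm_vec2_power2: "norm (p :: real ^ 2) ^ 2 = p $ 1 ^ 2 + p $ 2 ^ 2"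
  unfolding power2_norm_eq_inner by (simp add: inner_vec_def sum_2 power2_eq_square)

lemma norm_vec2_power4: "norm (p :: real ^ 2) ^ 4 = (p $ 1 ^ 2 + p $ 2 ^ 2) ^ 2"
  by (simp flip: norm_vec2_power2 power_mult)

lemma partial_quartic:
  fixes p :: "real ^ 2"
  shows "partial j (\<lambda>p. A * norm p ^ 4 + c) p = 4 * A * (p $ 1 ^ 2 + p $ 2 ^ 2) * p $ j"
proof -
  consider "j = 1" | "j = 2"
    using exhaust_2 by blast
  then show ?thesis
    unfolding norm_vec2_power4
    by cases (rule partial_eqI; auto intro!: derivative_eq_intros
        simp: axis_def power2_eq_square algebra_simps)+
qed

lemma partial2_quartic:
  fixes p :: "real ^ 2"
  shows "partial i (partial j (\<lambda>p. A * norm p ^ 4 + c)) p =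
    4 * A * (2 * p $ i * p $ j + (if i = j then p $ 1 ^ 2 + p $ 2 ^ 2 else 0))"
proof -
  have eq: "partial j (\<lambda>p. A * norm p ^ 4 + c)
      = (\<lambda>p. 4 * A * (p $ 1 ^ 2 + p $ 2 ^ 2) * p $ j)"
    by (rule ext) (rule partial_quartic)
  consider "i = 1" "j = 1" | "i = 1" "j = 2" | "i = 2" "j = 1" | "i = 2" "j = 2"
    using exhaust_2 by metis
  then show ?thesis
    unfolding eq
    by cases (rule partial_eqI; auto intro!: derivative_eq_intros
        simp: axis_def power2_eq_square algebra_simps)+
qed

lemma det_hessian_quartic_0: "det (hessian (\<lambda>p :: real ^ 2. A * norm p ^ 4 + c) 0) = 0"
  by (simp add: det_2 hessian_def partial2_quartic)

lemma bilaplacian_quartic: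
  fixes p :: "real ^ 2"
  shows "laplacian (laplacian (\<lambda>p. A * norm p ^ 4 + c)) p = 64 * A"
proof -
  have lap: "laplacian (\<lambda>p :: real ^ 2. A * norm p ^ 4 + c)
      = (\<lambda>p. 16 * A * (p $ 1 ^ 2 + p $ 2 ^ 2))"
    unfolding laplacian_def sum_2 partial2_quartic
    by (rule ext) (simp add: power2_eq_square algebra_simps)
  have part: "partial i (\<lambda>p. 16 * A * (p $ 1 ^ 2 + p $ 2 ^ 2)) p = 32 * A * p $ i"
    for i and p :: "real ^ 2"
  proof -
    consider "i = 1" | "i = 2"
      using exhaust_2 by blast
    then show ?thesis
      by cases (rule partial_eqI; auto intro!: derivative_eq_intros simp: axis_def)+
  qed
  have part2: "partial i (\<lambda>p. 32 * A * p $ i) p = 32 * A" for i and p :: "real ^ 2"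
    by (rule partial_eqI) (auto intro!: derivative_eq_intros simp: axis_def)
  have "partial i (partial i (\<lambda>p. 16 * A * (p $ 1 ^ 2 + p $ 2 ^ 2))) p = 32 * A" for i
    using part2 by (subst part[abs_def]) simp
  then show ?thesis
    unfolding lap by (simp add: laplacian_def sum_2)
qed

section \<open>The explicit function solves the equation\<close>

lemma smooth_on_explicit_solution:
  assumes pos: "\<And>t. t \<in> J \<Longrightarrow> 0 < 1 - 48 * a0 * t"
  shows "smooth_on (cball 0 1 \<times> J) (\<lambda>(p, t). cartesian (explicit_solution a0) t p)"
  unfolding smooth_on_def
proof
  fix k
  let ?S = "cball (0 :: real ^ 2) 1 \<times> J"
  let ?g = "\<lambda>z :: (real ^ 2) \<times> real. 1 + (-48 * a0) * snd z"
  have coord: "Ck_on k ?S (\<lambda>z. fst z $ i)" for i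
    by (intro Ck_on_bounded_linear bounded_linear_compose[OF bounded_linear_vec_nth bounded_linear_fst])
  have g: "Ck_on k ?S ?g"
    by (intro Ck_on_add Ck_on_mult Ck_on_const Ck_on_bounded_linear bounded_linear_snd)
  have gpos: "?g z > 0" if "z \<in> ?S" for z
    using that pos by auto
  then have "?g z \<noteq> 0" if "z \<in> ?S" for z
    using that by (metis less_irrefl)
  then have inv: "Ck_on k ?S (\<lambda>z. inverse (?g z))"
    using g by (intro Ck_on_inverse) auto
  have ln: "Ck_on k ?S (\<lambda>z. ln (?g z))"
    using g gpos by (intro Ck_on_ln) auto
  let ?q = "\<lambda>z :: (real ^ 2) \<times> real. fst z $ 1 * fst z $ 1 + fst z $ 2 * fst z $ 2"
  have "Ck_on k ?S (\<lambda>z. a0 * inverse (?g z) * (?q z * ?q z) + 4 / 3 * ln (?g z))"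
    by (intro Ck_on_add Ck_on_mult Ck_on_const coord inv ln)
  moreover have "(\<lambda>(p, t). cartesian (explicit_solution a0) t p)
      = (\<lambda>z. a0 * inverse (?g z) * (?q z * ?q z) + 4 / 3 * ln (?g z))"
    by (rule ext) (simp only: cartesian_def explicit_solution_def norm_vec2_power4
        power2_eq_square divide_inverse split_beta mult_minus_left diff_conv_add_uminus)
  ultimately show "Ck_on k ?S (\<lambda>(p, t). cartesian (explicit_solution a0) t p)"
    by simp
qed

lemma vector_derivative_explicit_solution:
  assumes pos: "0 < 1 - 48 * a0 * t" and lim: "at t within J \<noteq> bot"
  shows "vector_derivative (explicit_solution a0 r) (at t within J)
    = 48 * (a0 / (1 - 48 * a0 * t)) ^ 2 * r ^ 4 - 64 * (a0 / (1 - 48 * a0 * t))"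
proof -
  have nz: "1 - 48 * a0 * t \<noteq> 0"
    using pos by simp
  have A: "((\<lambda>s. a0 / (1 - 48 * a0 * s)) has_real_derivative
      a0 * (48 * a0) / ((1 - 48 * a0 * t) * (1 - 48 * a0 * t))) (at t within J)"
    using nz by (auto intro!: derivative_eq_intros)
  have L: "((\<lambda>s. ln (1 - 48 * a0 * s)) has_real_derivative
      - (48 * a0) / (1 - 48 * a0 * t)) (at t within J)"
    using pos by (auto intro!: derivative_eq_intros)
  have "((\<lambda>s. a0 / (1 - 48 * a0 * s) * r ^ 4 + 4 / 3 * ln (1 - 48 * a0 * s)) has_real_derivative
      a0 * (48 * a0) / ((1 - 48 * a0 * t) * (1 - 48 * a0 * t)) * r ^ 4
        + 4 / 3 * (- (48 * a0) / (1 - 48 * a0 * t))) (at t within J)"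
    by (intro DERIV_add DERIV_cmult_right DERIV_cmult A L)
  also have "a0 * (48 * a0) / ((1 - 48 * a0 * t) * (1 - 48 * a0 * t)) * r ^ 4
        + 4 / 3 * (- (48 * a0) / (1 - 48 * a0 * t))
      = 48 * (a0 / (1 - 48 * a0 * t)) ^ 2 * r ^ 4 - 64 * (a0 / (1 - 48 * a0 * t))"
    by (simp add: power2_eq_square)
  finally have "(explicit_solution a0 r has_vector_derivative
      48 * (a0 / (1 - 48 * a0 * t)) ^ 2 * r ^ 4 - 64 * (a0 / (1 - 48 * a0 * t))) (at t within J)"
    by (simp add: has_real_derivative_iff_has_vector_derivative explicit_solution_def[abs_def])
  with lim show ?thesis
    by (rule vector_derivative_within)
qed

lemma radial_solution_explicit_solution:
  assumes pos: "\<And>t. t \<in> J \<Longrightarrow> 0 < 1 - 48 * a0 * t"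
    and lim: "\<And>t. t \<in> J \<Longrightarrow> at t within J \<noteq> bot"
  shows "radial_solution J (explicit_solution a0)"
  unfolding radial_solution_def
proof (intro conjI ballI)
  show "smooth_on (cball 0 1 \<times> J) (\<lambda>(p, t). cartesian (explicit_solution a0) t p)"
    using pos by (rule smooth_on_explicit_solution)
next
  fix t assume t: "t \<in> J"
  define A where "A = a0 / (1 - 48 * a0 * t)"
  define c where "c = 4 / 3 * ln (1 - 48 * a0 * t)"
  have u: "(\<lambda>r. explicit_solution a0 r t) = (\<lambda>r. A * r ^ 4 + c)"
    by (simp add: explicit_solution_def A_def c_def)
  have cart: "cartesian (explicit_solution a0) t = (\<lambda>p. A * norm p ^ 4 + c)"
    by (rule ext) (simp add: cartesian_def explicit_solution_def A_def c_def)
  have vd: "vector_derivative (\<lambda>s. explicit_solution a0 r s) (at t within J)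
      = 48 * A ^ 2 * r ^ 4 - 64 * A" for r
    unfolding A_def using pos[OF t] lim[OF t] by (rule vector_derivative_explicit_solution)
  show "vector_derivative (\<lambda>s. explicit_solution a0 r s) (at t within J)
      = Dr (\<lambda>r. explicit_solution a0 r t) r * Dr (Dr (\<lambda>r. explicit_solution a0 r t)) r / r
        - radial_laplacian (radial_laplacian (\<lambda>r. explicit_solution a0 r t)) r"
    if "r \<in> {0<..1}" for r
  proof -
    have r: "r \<in> {0..1}" "r \<noteq> 0"
      using that by auto
    show ?thesis
      unfolding u vd Dr_quartic[OF r(1)] Dr2_quartic[OF r(1)] radial_bilaplacian_quartic[OF that]
      using r(2) by (simp add: power2_eq_square power3_eq_cube power4_eq_xxxx)
  qed
  show "vector_derivative (\<lambda>s. cartesian (explicit_solution a0) s 0) (at t within J)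
      = det (hessian (cartesian (explicit_solution a0) t) 0)
        - laplacian (laplacian (cartesian (explicit_solution a0) t)) 0"
    unfolding cart det_hessian_quartic_0 bilaplacian_quartic
    using vd[of 0] by (simp add: cartesian_def)
  have Dr_pow2: "(Dr ^^ 2) f = Dr (Dr f)" and Dr_pow3: "(Dr ^^ 3) f = Dr (Dr (Dr f))" for f
    by (simp_all add: eval_nat_numeral)
  have in01: "0 \<in> {0..1::real}" "1 \<in> {0..1::real}"
    by simp_all
  show "3 * Dr (\<lambda>r. explicit_solution a0 r t) 1 = (Dr ^^ 2) (\<lambda>r. explicit_solution a0 r t) 1"
    "2 * (Dr ^^ 2) (\<lambda>r. explicit_solution a0 r t) 1 = (Dr ^^ 3) (\<lambda>r. explicit_solution a0 r t) 1"
    "Dr (\<lambda>r. explicit_solution a0 r t) 0 = 0"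
    "(Dr ^^ 3) (\<lambda>r. explicit_solution a0 r t) 0 = 0"
    unfolding u Dr_pow2 Dr_pow3 Dr_quartic[OF in01(1)] Dr_quartic[OF in01(2)]
      Dr2_quartic[OF in01(2)] Dr3_quartic[OF in01(1)] Dr3_quartic[OF in01(2)]
    by simp_all
qed

section \<open>Blow-up\<close>

text \<open>Continuity of the profiles makes the supremum over \<open>[0, 1]\<close> finite, so that it is a genuine
  upper bound of the values at a single radius.\<close>

lemma blows_up_if_diverges_at:
  assumes r: "r \<in> {0..1}" and lim: "filterlim (\<lambda>t. \<bar>u r t\<bar>) at_top F"
    and cont: "\<And>t. continuous_on {0..1} (\<lambda>r. u r t)"
  shows "blows_up u F"
  unfolding blows_up_def
proof (rule filterlim_at_top_mono[OF lim], intro always_eventually allI)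
  fix t
  have "compact ((\<lambda>r. \<bar>u r t\<bar>) ` {0..1})"
    using cont by (intro compact_continuous_image continuous_on_rabs) auto
  then have "bdd_above ((\<lambda>r. \<bar>u r t\<bar>) ` {0..1})"
    by (intro bounded_imp_bdd_above compact_imp_bounded)
  with r show "\<bar>u r t\<bar> \<le> (SUP r\<in>{0..1}. \<bar>u r t\<bar>)"
    by (rule cSUP_upper)
qed

lemma continuous_on_explicit_solution: "continuous_on S (\<lambda>r. explicit_solution a0 r t)"
  unfolding explicit_solution_def
  by (intro continuous_on_add continuous_on_mult_left continuous_on_power continuous_on_id
      continuous_on_const)

lemma at_within_neq_bot_if_right_subset:
  fixes t e :: real
  assumes "t < e" "{t<..<e} \<subseteq> J"
  shows "at t within J \<noteq> bot"
  using islimpt_subset[OF islimpt_greaterThanLessThan1[OF assms(1)] assms(2)]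
  by (simp add: trivial_limit_within)

lemma explicit_solution_at_top:
  assumes "a0 < 0"
  shows "filterlim (\<lambda>t. explicit_solution a0 r t) at_top at_top"
proof -
  have g: "filterlim (\<lambda>t. 1 - 48 * a0 * t) at_top at_top"
    using assms by real_asymp
  have "filterlim (\<lambda>x. a0 / x * r ^ 4 + 4 / 3 * ln x) at_top at_top"
    by real_asymp
  from filterlim_compose[OF this g] show ?thesis
    by (simp add: explicit_solution_def)
qed

lemma filterlim_at_right_0_at_blow_up_time:
  fixes a0 :: real
  assumes "a0 > 0"
  shows "filterlim (\<lambda>t. 1 - 48 * a0 * t) (at_right 0) (at_left (1 / (48 * a0)))"
  unfolding filterlim_at
proof
  have "((\<lambda>t. 1 - 48 * a0 * t) \<longlongrightarrow> 1 - 48 * a0 * (1 / (48 * a0))) (at_left (1 / (48 * a0)))"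
    by (intro tendsto_intros)
  with assms show "((\<lambda>t. 1 - 48 * a0 * t) \<longlongrightarrow> 0) (at_left (1 / (48 * a0)))"
    by simp
  have "\<forall>\<^sub>F t in at_left (1 / (48 * a0)). t < 1 / (48 * a0)"
    by (simp add: eventually_at_filter)
  then show "\<forall>\<^sub>F t in at_left (1 / (48 * a0)). 1 - 48 * a0 * t \<in> {0<..} \<and> 1 - 48 * a0 * t \<noteq> 0"
    by eventually_elim (use assms in \<open>auto simp: field_simps\<close>)
qed

lemma explicit_solution_origin_at_bot:
  assumes "a0 > 0"
  shows "filterlim (\<lambda>t. explicit_solution a0 0 t) at_bot (at_left (1 / (48 * a0)))"
proof -
  have "filterlim (\<lambda>x::real. 4 / 3 * ln x) at_bot (at_right 0)"
    by real_asymp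
  from filterlim_compose[OF this filterlim_at_right_0_at_blow_up_time[OF assms]] show ?thesis
    by (simp add: explicit_solution_def)
qed

lemma explicit_solution_off_origin_at_top:
  assumes "a0 > 0" "r > 0"
  shows "filterlim (\<lambda>t. explicit_solution a0 r t) at_top (at_left (1 / (48 * a0)))"
proof -
  define b where "b = a0 * r ^ 4"
  have "b > 0"
    using assms by (simp add: b_def)
  then have "filterlim (\<lambda>x::real. b / x + 4 / 3 * ln x) at_top (at_right 0)"
    by real_asymp
  from filterlim_compose[OF this filterlim_at_right_0_at_blow_up_time[OF assms(1)]] show ?thesis
    by (simp add: explicit_solution_def b_def)
qed

theorem mainTheorem2:
  fixes a0 :: real
  shows "radial_solution {t. 0 \<le> t \<and> 0 < 1 - 48 * a0 * t} (explicit_solution a0)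
    \<and> (a0 = 0 \<longrightarrow> (\<forall>t\<ge>0. \<forall>r\<in>{0..1}. explicit_solution a0 r t = 0))
    \<and> (a0 < 0 \<longrightarrow>
        radial_solution {0..} (explicit_solution a0)
        \<and> blows_up (explicit_solution a0) at_top
        \<and> (\<forall>r\<in>{0..1}. filterlim (\<lambda>t. explicit_solution a0 r t) at_top at_top))
    \<and> (a0 > 0 \<longrightarrow>
        radial_solution {0..<1 / (48 * a0)} (explicit_solution a0)
        \<and> blows_up (explicit_solution a0) (at_left (1 / (48 * a0)))
        \<and> filterlim (\<lambda>t. explicit_solution a0 0 t) at_bot (at_left (1 / (48 * a0)))
        \<and> (\<forall>r\<in>{0<..1}.
              filterlim (\<lambda>t. explicit_solution a0 r t) at_top (at_left (1 / (48 * a0)))))"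
proof -
  let ?J = "{t. 0 \<le> t \<and> 0 < 1 - 48 * a0 * t}"
  have J_nonpos: "?J = {0..}" if "a0 \<le> 0"
  proof -
    have "a0 * t \<le> 0" if "t \<ge> 0" for t
      using that \<open>a0 \<le> 0\<close> by (simp add: mult_nonpos_nonneg)
    then show ?thesis
      by (force simp: mult.assoc)
  qed
  have J_pos: "?J = {0..<1 / (48 * a0)}" if "a0 > 0"
    using that by (auto simp: field_simps)
  have sol: "radial_solution ?J (explicit_solution a0)"
  proof (rule radial_solution_explicit_solution)
    fix t assume t: "t \<in> ?J"
    show "at t within ?J \<noteq> bot"
    proof (cases "a0 > 0")
      case True
      have "0 \<le> t" "t < 1 / (48 * a0)"
        using t unfolding J_pos[OF True] by simp_all
      then show ?thesis
        unfolding J_pos[OF True]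
        by (intro at_within_neq_bot_if_right_subset[of t "1 / (48 * a0)"]) auto
    next
      case False
      then have J: "?J = {0..}"
        by (intro J_nonpos) simp
      have "0 \<le> t"
        using t by simp
      then show ?thesis
        unfolding J by (intro at_within_neq_bot_if_right_subset[of t "t + 1"]) auto
    qed
  qed simp
  have zero: "explicit_solution a0 r t = 0" if "a0 = 0" for r t
    using that by (simp add: explicit_solution_def)
  have neg: "blows_up (explicit_solution a0) at_top" if "a0 < 0"
    by (rule blows_up_if_diverges_at[of 0])
      (auto intro: continuous_on_explicit_solution
        filterlim_compose[OF filterlim_abs_real explicit_solution_at_top[OF that]])
  have pos: "blows_up (explicit_solution a0) (at_left (1 / (48 * a0)))" if "a0 > 0"
  proof (rule blows_up_if_diverges_at[of 0])
    have "filterlim (\<lambda>t. - explicit_solution a0 0 t) at_top (at_left (1 / (48 * a0)))"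
      using explicit_solution_origin_at_bot[OF that] by (simp add: filterlim_uminus_at_bot)
    then show "filterlim (\<lambda>t. \<bar>explicit_solution a0 0 t\<bar>) at_top (at_left (1 / (48 * a0)))"
      by (rule filterlim_at_top_mono) (intro always_eventually allI abs_ge_minus_self)
  qed (auto intro: continuous_on_explicit_solution)
  show ?thesis
  proof (intro conjI impI)
    show "radial_solution {0..} (explicit_solution a0)" if "a0 < 0"
      using sol J_nonpos that by simp
    show "radial_solution {0..<1 / (48 * a0)} (explicit_solution a0)" if "a0 > 0"
      using sol J_pos[OF that] by simp
  qed (use sol zero neg pos explicit_solution_at_top explicit_solution_origin_at_bot
      explicit_solution_off_origin_at_top in auto)
qed

end
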